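(* Let $\Bbbk$ be a field and $N\ge3$. The affine nilTemperley-Lieb algebra $\mathrm{n}\widehat{\mathrm{TL}}_N$ is finitely generated over its center (i.e. it is a finitely generated module over its center).
   Context: The affine nilTemperley-Lieb algebra $\mathrm{n}\widehat{\mathrm{TL}}_N$ ($N\ge3$) is the unital associative $\Bbbk$-algebra with generators $a_0,\dots,a_{N-1}$ and relations $a_i^2=0$, $a_ia_j=a_ja_i$ for $i-j\not\equiv\pm1 \pmod N$, and $a_ia_{i+1}a_i=a_{i+1}a_ia_{i+1}=0$ for all $i$, all indices modulo $N$. *)

theory Defs
  imports
    "HOL-Library.Poly_Mapping"
    "HOL-Number_Theory.Cong"
    "HOL-Algebra.QuotRing"
begin

text \<open>Words under concatenation form the free monoid. The operation is written additively
  because the product on \<open>'a \<Rightarrow>\<^sub>0 'b\<close> from \<open>Poly_Mapping\<close> is the convolution over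
  an additively written (not necessarily commutative) key monoid. A wrapper type is used to
  avoid a global \<open>monoid_add\<close> instance on lists.\<close>

datatype 'a free_monoid = Word (letters: "'a list")

instantiation free_monoid :: (type) monoid_add
begin

definition zero_free_monoid :: "'a free_monoid"
  where "0 = Word []"

definition plus_free_monoid :: "'a free_monoid \<Rightarrow> 'a free_monoid \<Rightarrow> 'a free_monoid"
  where "u + v = Word (letters u @ letters v)"

instance
  by standard (simp_all add: zero_free_monoid_def plus_free_monoid_def)

end

text \<open>The free associative unital algebra on the set \<open>X\<close>: the monoid algebra of the free
  monoid, i.e. finitely supported coefficient functions on the words over \<open>X\<close>. The scalars
  \<open>c\<close> are the elements \<open>Poly_Mapping.single 0 c\<close>, so two-sided ring ideals are
  the same as algebra ideals.\<close>

definition free_algebra :: "'a set \<Rightarrow> ('a free_monoid \<Rightarrow>\<^sub>0 'k::field) ring"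
  where "free_algebra X =
    \<lparr>carrier = {p. \<forall>w \<in> Poly_Mapping.keys p. set (letters w) \<subseteq> X},
     mult = (*), one = 1, zero = 0, add = (+)\<rparr>"

definition gen :: "'a \<Rightarrow> ('a free_monoid \<Rightarrow>\<^sub>0 'k::field)"
  where "gen x = Poly_Mapping.single (Word [x]) 1"

text \<open>Each element \<open>r\<close> of this set stands for the relation \<open>r = 0\<close>.\<close>

definition affine_nilTL_relations :: "nat \<Rightarrow> (nat free_monoid \<Rightarrow>\<^sub>0 'k::field) set"
  where "affine_nilTL_relations N =
      {gen i * gen i | i. i < N}
    \<union> {gen i * gen j - gen j * gen i | i j. i < N \<and> j < N \<and>
         \<not> [int i - int j = 1] (mod int N) \<and> \<not> [int i - int j = - 1] (mod int N)}
    \<union> {gen i * gen ((i + 1) mod N) * gen i | i. i < N}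
    \<union> {gen ((i + 1) mod N) * gen i * gen ((i + 1) mod N) | i. i < N}"

definition affine_nilTL :: "nat \<Rightarrow> (nat free_monoid \<Rightarrow>\<^sub>0 'k::field) set ring"
  where "affine_nilTL N =
    free_algebra {..<N} Quot (Idl\<^bsub>free_algebra {..<N}\<^esub> (affine_nilTL_relations N))"

definition ring_center :: "('a, 'm) ring_scheme \<Rightarrow> 'a set"
  where "ring_center R =
    {z \<in> carrier R. \<forall>x \<in> carrier R. z \<otimes>\<^bsub>R\<^esub> x = x \<otimes>\<^bsub>R\<^esub> z}"

text \<open>\<open>R\<close> is finitely generated as a left module over its subring \<open>C\<close>.\<close>

definition finitely_generated_over :: "('a, 'm) ring_scheme \<Rightarrow> 'a set \<Rightarrow> bool"
  where "finitely_generated_over R C \<longleftrightarrow>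
    (\<exists>S. finite S \<and> S \<subseteq> carrier R \<and>
       (\<forall>x \<in> carrier R. \<exists>c \<in> S \<rightarrow> C. x = (\<Oplus>\<^bsub>R\<^esub>s\<in>S. c s \<otimes>\<^bsub>R\<^esub> s)))"

lemma ring_free_algebra: "ring (free_algebra X :: ('a free_monoid \<Rightarrow>\<^sub>0 'k::field) ring)"
proof -
  let ?R = "free_algebra X :: ('a free_monoid \<Rightarrow>\<^sub>0 'k) ring"
  have uminus: "- p \<in> carrier ?R" if "p \<in> carrier ?R" for p
    using that by (simp add: free_algebra_def)
  have plus: "p + q \<in> carrier ?R" if "p \<in> carrier ?R" "q \<in> carrier ?R" for p q
    using that Poly_Mapping.keys_add[of p q] by (auto simp: free_algebra_def)
  have times: "p * q \<in> carrier ?R" if "p \<in> carrier ?R" "q \<in> carrier ?R" for p q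
    using that keys_mult[of p q] by (fastforce simp: free_algebra_def plus_free_monoid_def)
  have one: "1 \<in> carrier ?R"
    by (simp add: free_algebra_def zero_free_monoid_def)
  have simps: "x \<oplus>\<^bsub>?R\<^esub> y = x + y" "x \<otimes>\<^bsub>?R\<^esub> y = x * y"
    "\<zero>\<^bsub>?R\<^esub> = 0" "\<one>\<^bsub>?R\<^esub> = 1" for x y
    by (simp_all add: free_algebra_def)
  have zero: "0 \<in> carrier ?R"
    by (simp add: free_algebra_def)
  show ?thesis
  proof (rule ringI)
    show "abelian_group ?R"
    proof (rule abelian_groupI)
      fix p assume "p \<in> carrier ?R"
      then show "\<exists>q\<in>carrier ?R. q \<oplus>\<^bsub>?R\<^esub> p = \<zero>\<^bsub>?R\<^esub>"
        by (intro bexI[of _ "- p"] uminus) (simp_all add: simps)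
    qed (simp_all add: simps plus zero add.assoc add.commute)
    show "Group.monoid ?R"
      by (rule monoidI) (simp_all add: simps times one mult.assoc)
  qed (simp_all add: simps distrib_left distrib_right)
qed

lemma gen_closed: "x \<in> X \<Longrightarrow> gen x \<in> carrier (free_algebra X)"
  by (simp add: free_algebra_def gen_def)

lemma affine_nilTL_relations_closed:
  "(affine_nilTL_relations N :: (nat free_monoid \<Rightarrow>\<^sub>0 'k::field) set)
     \<subseteq> carrier (free_algebra {..<N})"
proof -
  interpret ring "free_algebra {..<N} :: (nat free_monoid \<Rightarrow>\<^sub>0 'k) ring"
    by (rule ring_free_algebra)
  let ?R = "free_algebra {..<N} :: (nat free_monoid \<Rightarrow>\<^sub>0 'k) ring"
  have g: "gen i \<in> carrier ?R" if "i < N" for i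
    using that by (simp add: gen_closed)
  have m: "p * q \<in> carrier ?R" if "p \<in> carrier ?R" "q \<in> carrier ?R" for p q
    using m_closed[OF that] by (simp add: free_algebra_def)
  have d: "p - q \<in> carrier ?R" if "p \<in> carrier ?R" "q \<in> carrier ?R" for p q
  proof -
    have "- q \<in> carrier ?R"
      using that(2) by (simp add: free_algebra_def)
    from a_closed[OF that(1) this] show ?thesis
      by (simp add: free_algebra_def)
  qed
  have s: "(i + 1) mod N < N" if "i < N" for i
    using that by simp
  show ?thesis
  proof
    fix r assume "r \<in> (affine_nilTL_relations N :: (nat free_monoid \<Rightarrow>\<^sub>0 'k) set)"
    then consider i where "i < N" "r = gen i * gen i"
      | i j where "i < N" "j < N" "r = gen i * gen j - gen j * gen i"
      | i where "i < N" "r = gen i * gen ((i + 1) mod N) * gen i"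
      | i where "i < N" "r = gen ((i + 1) mod N) * gen i * gen ((i + 1) mod N)"
      unfolding affine_nilTL_relations_def by blast
    then show "r \<in> carrier ?R"
      by cases (simp_all only: g m d s)
  qed
qed

lemma ring_affine_nilTL: "ring (affine_nilTL N :: (nat free_monoid \<Rightarrow>\<^sub>0 'k::field) set ring)"
  unfolding affine_nilTL_def
  by (intro ideal.quotient_is_ring ring.genideal_ideal ring_free_algebra
      affine_nilTL_relations_closed)

end

theory Submission
  imports Defs
begin

text \<open>
  Put the generators on the vertices of a cycle with \<open>N\<close> vertices; two generators commute unless
  they are adjacent. The relations are used through two facts about words.

  \<^item> If a word has a nonzero product, then between two occurrences of a letter both of its neighbours
    occur (\<open>word_prod_sandwich_zero\<close>). Hence, for each edge, the letters at its two ends alternate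
    in the word (\<open>word_prod_nonzero_alternating\<close>).
  \<^item> A word can be recovered, up to commutations, from its subwords on the edges, so these
    edge projections determine the product (\<open>word_prod_cong_edge_projections\<close>).

  Consider the words in which each letter occurs exactly once, and let \<open>t\<close> be the sum of their
  products, with one summand for each system of edge projections. In terms of particles hopping
  on the cycle, each summand moves every particle to the place of the next one.

  The element \<open>t\<close> is central. If \<open>u a\<^sub>i\<close> is nonzero for such a word \<open>u\<close>, then \<open>i\<close> stands before both of its
  neighbours in \<open>u\<close>, hence it can be pulled to the front, and \<open>u a\<^sub>i = a\<^sub>i v\<close>, where \<open>v\<close> arises from \<open>u\<close>
  by moving \<open>i\<close> to the end. The symmetric argument applies to \<open>a\<^sub>i v\<close>, so \<open>t a\<^sub>i\<close> and \<open>a\<^sub>i t\<close> are sums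
  over the same edge projections (\<open>turn_sum_commute_gen\<close>).

  Long words are multiples of \<open>t\<close>. Since adjacent letters alternate, their multiplicities differ by
  at most one, so in a word of length above \<open>N (N + 1)\<close> with nonzero product every letter occurs at least
  twice. Let \<open>u\<close> consist of the first occurrences of the letters and \<open>v\<close> of the remaining ones. By
  alternation, \<open>u\<close> followed by \<open>v\<close> has the same edge projections as the word. In \<open>t v\<close> only the summand
  of \<open>u\<close> survives, because the first letter of \<open>v\<close> on an edge forces the order of the two letters
  before it. So the word equals \<open>t v\<close> with \<open>v\<close> shorter (\<open>long_word_factors\<close>), and by induction the words of
  length at most \<open>N (N + 1)\<close> generate the algebra over the polynomials in \<open>t\<close>.
\<close>

section \<open>Words on the cycle and their projections to edges\<close>

definition cyc_adj :: "nat \<Rightarrow> nat \<Rightarrow> nat \<Rightarrow> bool"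
  where "cyc_adj N i j \<longleftrightarrow> i < N \<and> j < N \<and> (j = (i + 1) mod N \<or> i = (j + 1) mod N)"

lemma cyc_adj_sym: "cyc_adj N i j \<Longrightarrow> cyc_adj N j i"
  by (auto simp: cyc_adj_def)

lemma cyc_adj_less: "cyc_adj N i j \<Longrightarrow> i < N" "cyc_adj N i j \<Longrightarrow> j < N"
  by (auto simp: cyc_adj_def)

lemma cyc_adj_irrefl: "N \<ge> 3 \<Longrightarrow> \<not> cyc_adj N i i"
  by (auto simp: cyc_adj_def mod_Suc split: if_splits)

text \<open>A vertex of the cycle has at most two neighbours: a neighbour other than \<open>y\<close> is determined.\<close>

lemma cyc_adj_other_unique:
  assumes "cyc_adj N x y" "cyc_adj N x z" "cyc_adj N x v" "z \<noteq> y" "v \<noteq> y"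
  shows "v = z"
  using assms unfolding cyc_adj_def by (auto simp: mod_Suc split: if_splits)

lemma cyc_adj_succ: "i < N \<Longrightarrow> cyc_adj N i ((i + 1) mod N)"
  by (auto simp: cyc_adj_def)

lemma cyc_adj_if_cong:
  assumes "i < N" "j < N" "[int i - int j = 1] (mod int N) \<or> [int i - int j = - 1] (mod int N)"
  shows "cyc_adj N i j"
proof -
  have succ: "i' = (j' + 1) mod N" if "i' < N" "[int i' - int j' = 1] (mod int N)" for i' j'
  proof -
    have "[int i' = int (j' + 1)] (mod int N)"
      using cong_add[OF that(2) cong_refl[of "int j'"]] by (simp add: add.commute)
    then have "[i' = j' + 1] (mod N)"
      by (simp only: cong_int_iff)
    then show ?thesis
      using that(1) by (simp add: cong_def)
  qed
  have "[int j - int i = 1] (mod int N)" if "[int i - int j = - 1] (mod int N)"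
    using cong_minus_minus_iff[of "int i - int j" "- 1" "int N"] that by simp
  then show ?thesis
    using succ[of i j] succ[of j i] assms by (auto simp: cyc_adj_def)
qed

text \<open>The value off the edges is constant, so two words have equal projections as functions iff they agree
  on every edge.\<close>

definition edge_projections :: "nat \<Rightarrow> nat list \<Rightarrow> nat \<times> nat \<Rightarrow> nat list"
  where "edge_projections N w =
    (\<lambda>(x, y). if cyc_adj N x y then filter (\<lambda>z. z = x \<or> z = y) w else [])"

lemma edge_projections_append:
  "edge_projections N (u @ v) e = edge_projections N u e @ edge_projections N v e"
  by (cases e) (simp add: edge_projections_def)

lemma edge_projections_append_cong:
  "edge_projections N u = edge_projections N u' \<Longrightarrow> edge_projections N v = edge_projections N v'
    \<Longrightarrow> edge_projections N (u @ v) = edge_projections N (u' @ v')"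
  by (simp add: edge_projections_append fun_eq_iff)

text \<open>Moving a letter across letters that are neither equal nor adjacent to it is invisible on every edge.\<close>

lemma edge_projections_rotate:
  assumes "i \<notin> set q" "\<And>y. cyc_adj N i y \<Longrightarrow> y \<notin> set q"
  shows "edge_projections N (i # q) = edge_projections N (q @ [i])"
proof
  fix e :: "nat \<times> nat"
  obtain x y where [simp]: "e = (x, y)" by (cases e)
  show "edge_projections N (i # q) e = edge_projections N (q @ [i]) e"
  proof (cases "cyc_adj N x y \<and> (x = i \<or> y = i)")
    case True
    then have "filter (\<lambda>z. z = x \<or> z = y) q = []"
      using assms cyc_adj_sym by (auto simp: filter_empty_conv)
    then show ?thesis by (simp add: edge_projections_def)
  next
    case False
    then show ?thesis by (auto simp: edge_projections_def)
  qed
qed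

lemma not_distinct_adjE:
  assumes "\<not> distinct_adj l"
  obtains p x r where "l = p @ x # x # r"
proof -
  have "\<exists>p x r. l = p @ x # x # r"
    using assms
  proof (induction l rule: induct_list012)
    case (3 x y zs)
    show ?case
    proof (cases "x = y")
      case True
      then show ?thesis by (metis append_Nil)
    next
      case False
      then obtain p z r where "y # zs = p @ z # z # r" using 3 by auto
      then show ?thesis by (metis append_Cons)
    qed
  qed auto
  then show thesis using that by blast
qed

lemma filter_adjacent_equalE:
  assumes "filter P w = p @ x # x # r"
  obtains p' q r' where "w = p' @ x # q @ x # r'" "\<And>z. z \<in> set q \<Longrightarrow> \<not> P z"
proof -
  have "\<exists>p' q r'. w = p' @ x # q @ x # r' \<and> (\<forall>z\<in>set q. \<not> P z)"
    using assms
  proof (induction p arbitrary: w)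
    case Nil
    then obtain u v where "w = u @ x # v" and v: "x # r = filter P v"
      by (auto simp: filter_eq_Cons_iff)
    moreover obtain q r' where "v = q @ x # r'" "\<forall>z\<in>set q. \<not> P z"
      using v by (auto simp: Cons_eq_filter_iff)
    ultimately show ?case by blast
  next
    case (Cons a p)
    then obtain u v where w: "w = u @ a # v" and "filter P v = p @ x # x # r"
      by (auto simp: filter_eq_Cons_iff)
    with Cons.IH obtain p' q r' where "v = p' @ x # q @ x # r'" "\<forall>z\<in>set q. \<not> P z"
      by blast
    with w have "w = (u @ a # p') @ x # q @ x # r'" by simp
    with \<open>\<forall>z\<in>set q. \<not> P z\<close> show ?case by blast
  qed
  then show thesis using that by blast
qed

fun first_occurrences :: "'a set \<Rightarrow> 'a list \<Rightarrow> 'a list" where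
  "first_occurrences A [] = []"
| "first_occurrences A (x # w) =
    (if x \<in> A then x # first_occurrences (A - {x}) w else first_occurrences A w)"

fun later_occurrences :: "'a set \<Rightarrow> 'a list \<Rightarrow> 'a list" where
  "later_occurrences A [] = []"
| "later_occurrences A (x # w) =
    (if x \<in> A then later_occurrences (A - {x}) w else x # later_occurrences A w)"

lemma set_first_occurrences: "set (first_occurrences A w) = A \<inter> set w"
  by (induction w arbitrary: A) auto

lemma distinct_first_occurrences: "distinct (first_occurrences A w)"
  by (induction w arbitrary: A) (auto simp: set_first_occurrences)

lemma length_first_later_occurrences:
  "length (first_occurrences A w) + length (later_occurrences A w) = length w"
  by (induction w arbitrary: A) auto

lemma set_later_occurrences: "set (later_occurrences A w) \<subseteq> set w"
proof (induction w arbitrary: A)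
  case (Cons x w)
  show ?case using Cons[of A] Cons[of "A - {x}"] by auto
qed simp

lemma count_later_occurrences:
  "count_list (later_occurrences A w) x = count_list w x - (if x \<in> A then 1 else 0)"
  by (induction w arbitrary: A) auto

text \<open>Extracting first occurrences commutes with restricting to an edge. This reduces the factorization of a word into
  first and later occurrences to alternating words in two letters.\<close>

lemma filter_first_occurrences:
  "filter P (first_occurrences A w) = first_occurrences {z \<in> A. P z} (filter P w)"
proof (induction w arbitrary: A)
  case (Cons x w)
  have "P x \<Longrightarrow> {z \<in> A - {x}. P z} = {z \<in> A. P z} - {x}"
    and "\<not> P x \<Longrightarrow> {z \<in> A - {x}. P z} = {z \<in> A. P z}" by auto
  with Cons show ?case by simp
qed simp

lemma filter_later_occurrences:
  "filter P (later_occurrences A w) = later_occurrences {z \<in> A. P z} (filter P w)"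
proof (induction w arbitrary: A)
  case (Cons x w)
  have "P x \<Longrightarrow> {z \<in> A - {x}. P z} = {z \<in> A. P z} - {x}"
    and "\<not> P x \<Longrightarrow> {z \<in> A - {x}. P z} = {z \<in> A. P z}" by auto
  with Cons show ?case by simp
qed simp

lemma later_occurrences_empty [simp]: "later_occurrences {} w = w"
  by (induction w) auto

lemma first_occurrences_empty [simp]: "first_occurrences {} w = []"
  by (induction w) auto

text \<open>The first two letters of an alternating word on \<open>x\<close> and \<open>y\<close> are the first occurrences of both.\<close>

lemma alternating_eq_first_later:
  assumes "distinct_adj l" "set l = {x, y}"
  shows "first_occurrences {x, y} l @ later_occurrences {x, y} l = l"
proof (cases "x = y")
  case True
  then show ?thesis using assms by (cases l) auto
next
  case False
  then obtain a b l' where l: "l = a # b # l'"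
    using assms(2) by (cases l; cases "tl l") auto
  then have "a \<noteq> b" using assms(1) by simp
  then have "{x, y} = {a, b}"
    using assms(2) l \<open>x \<noteq> y\<close> by (simp add: set_eq_iff) metis
  then show ?thesis using l \<open>a \<noteq> b\<close> by auto
qed

lemma edge_projections_first_later:
  assumes "\<And>x y. cyc_adj N x y \<Longrightarrow> distinct_adj (filter (\<lambda>z. z = x \<or> z = y) w)"
    and "set w = {..<N}"
  shows "edge_projections N (first_occurrences {..<N} w @ later_occurrences {..<N} w)
    = edge_projections N w"
proof
  fix e :: "nat \<times> nat"
  obtain x y where e: "e = (x, y)" by (cases e)
  show "edge_projections N (first_occurrences {..<N} w @ later_occurrences {..<N} w) e
    = edge_projections N w e"
  proof (cases "cyc_adj N x y")
    case True
    then have "{z \<in> {..<N}. z = x \<or> z = y} = {x, y}"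
      by (auto dest: cyc_adj_less)
    moreover have "set (filter (\<lambda>z. z = x \<or> z = y) w) = {x, y}"
      using assms(2) True by (auto dest: cyc_adj_less)
    ultimately show ?thesis
      using alternating_eq_first_later[OF assms(1)[OF True]] True e
      by (simp add: edge_projections_def filter_first_occurrences filter_later_occurrences)
  qed (simp add: e edge_projections_def)
qed

lemma count_alternating_le:
  fixes l :: "'a list"
  assumes "distinct_adj l" "set l \<subseteq> {x, y}"
  shows "count_list l x \<le> count_list l y + (if l \<noteq> [] \<and> hd l = x then 1 else 0)"
  using assms
proof (induction l)
  case (Cons a l)
  then show ?case by (cases l) (auto split: if_splits)
qed simp

lemma count_list_filter: "P x \<Longrightarrow> count_list (filter P w) x = count_list w x"
  by (induction w) auto

lemma count_adjacent_le:
  assumes "distinct_adj (filter (\<lambda>z. z = x \<or> z = y) w)"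
  shows "count_list w x \<le> count_list w y + 1"
proof -
  let ?l = "filter (\<lambda>z. z = x \<or> z = y) w"
  have "count_list ?l x \<le> count_list ?l y + (if ?l \<noteq> [] \<and> hd ?l = x then 1 else 0)"
    by (rule count_alternating_le[OF assms]) auto
  then have "count_list ?l x \<le> count_list ?l y + 1"
    by (simp split: if_splits)
  then show ?thesis by (simp add: count_list_filter)
qed

text \<open>By pigeonhole some letter occurs at least \<open>N + 2\<close> times. Multiplicities drop by at most one along each edge,
  and every vertex is fewer than \<open>N\<close> steps away.\<close>

lemma counts_ge_2_if_long:
  assumes "\<And>x y. cyc_adj N x y \<Longrightarrow> distinct_adj (filter (\<lambda>z. z = x \<or> z = y) w)"
    and "set w \<subseteq> {..<N}" "length w > N * (N + 1)" "j < N"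
  shows "count_list w j \<ge> 2"
proof -
  have "\<exists>i<N. count_list w i > N + 1"
  proof (rule ccontr)
    assume *: "\<not> ?thesis"
    then have "count_list w i \<le> N + 1" if "i \<in> {..<N}" for i
      using that * by (meson lessThan_iff not_less)
    from sum_bounded_above[of "{..<N}", OF this] have "(\<Sum>i<N. count_list w i) \<le> N * (N + 1)"
      by simp
    then show False using assms(3) sum_count_set[OF assms(2)] by simp
  qed
  then obtain i where i: "i < N" "count_list w i > N + 1" by blast
  have step: "count_list w i \<le> count_list w ((i + k) mod N) + k" for k
  proof (induction k)
    case (Suc k)
    have "cyc_adj N ((i + k) mod N) ((i + Suc k) mod N)"
      using cyc_adj_succ[of "(i + k) mod N" N] i(1) by (simp add: mod_Suc_eq)
    from count_adjacent_le[OF assms(1)[OF this]] Suc show ?case by simp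
  qed (use i in simp)
  \<comment> \<open>The number of steps from \<open>i\<close> forward to \<open>j\<close> on the cycle.\<close>
  define k where "k = (j + (N - i)) mod N"
  have "(i + k) mod N = (i + (j + (N - i))) mod N"
    by (simp add: k_def mod_add_right_eq)
  also have "i + (j + (N - i)) = j + N" using i(1) by simp
  finally have "(i + k) mod N = j" using \<open>j < N\<close> by simp
  moreover have "k < N" using i(1) by (simp add: k_def)
  ultimately show ?thesis using step[of k] i(2) by simp
qed

definition permutation_words :: "nat \<Rightarrow> nat list set"
  where "permutation_words N = {u. distinct u \<and> set u = {..<N}}"

lemma finite_permutation_words: "finite (permutation_words N)"
proof (rule finite_subset)
  have "length u = N" if "distinct u" "set u = {..<N}" for u
    using distinct_card[OF that(1)] that(2) by simp
  then show "permutation_words N \<subseteq> {u. set u \<subseteq> {..<N} \<and> length u = N}"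
    unfolding permutation_words_def by blast
  show "finite {u. set u \<subseteq> {..<N} \<and> length u = N}"
    by (rule finite_lists_length_eq) simp
qed

lemma set_permutation_words: "u \<in> permutation_words N \<Longrightarrow> set u \<subseteq> {..<N}"
  by (simp add: permutation_words_def)

section \<open>Products of generators subject to the affine nilTemperley-Lieb relations\<close>

text \<open>Any ring with elements that satisfy the relations is admitted, so that the computations with words are kept
  apart from cosets.\<close>

locale affine_nilTL_generators = ring R for R (structure) +
  fixes N :: nat and a :: "nat \<Rightarrow> 'a"
  assumes N_ge_3: "N \<ge> 3"
    and gens_closed: "i < N \<Longrightarrow> a i \<in> carrier R"
    and gens_square: "i < N \<Longrightarrow> a i \<otimes> a i = \<zero>"
    and gens_commute: "\<lbrakk>i < N; j < N; \<not> cyc_adj N i j\<rbrakk> \<Longrightarrow> a i \<otimes> a j = a j \<otimes> a i"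
    and gens_adjacent: "cyc_adj N i j \<Longrightarrow> a i \<otimes> a j \<otimes> a i = \<zero>"
begin

definition word_prod :: "nat list \<Rightarrow> 'a"
  where "word_prod w = foldr (\<lambda>i x. a i \<otimes> x) w \<one>"

lemma word_prod_Nil: "word_prod [] = \<one>"
  by (simp add: word_prod_def)

lemma word_prod_Cons: "word_prod (i # w) = a i \<otimes> word_prod w"
  by (simp add: word_prod_def)

lemma word_prod_closed: "set w \<subseteq> {..<N} \<Longrightarrow> word_prod w \<in> carrier R"
  by (induction w) (auto simp: word_prod_Nil word_prod_Cons gens_closed)

lemma word_prod_append:
  "\<lbrakk>set u \<subseteq> {..<N}; set v \<subseteq> {..<N}\<rbrakk> \<Longrightarrow> word_prod (u @ v) = word_prod u \<otimes> word_prod v"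
  by (induction u) (auto simp: word_prod_Nil word_prod_Cons gens_closed word_prod_closed m_assoc)

lemma word_prod_zero_context:
  assumes "set p \<subseteq> {..<N}" "set q \<subseteq> {..<N}" "set r \<subseteq> {..<N}" "word_prod q = \<zero>"
  shows "word_prod (p @ q @ r) = \<zero>"
  using assms by (simp add: word_prod_append word_prod_closed)

lemma word_prod_commute_gen:
  assumes "x < N" "set q \<subseteq> {..<N}" "\<And>y. y \<in> set q \<Longrightarrow> \<not> cyc_adj N x y"
  shows "word_prod (x # q) = word_prod (q @ [x])"
  using assms(2,3)
proof (induction q)
  case (Cons y q)
  have y: "y < N" "\<not> cyc_adj N x y" "set q \<subseteq> {..<N}" using Cons.prems by auto
  have "word_prod (x # y # q) = (a x \<otimes> a y) \<otimes> word_prod q"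
    using y assms(1) by (simp add: word_prod_Cons m_assoc gens_closed word_prod_closed)
  also have "\<dots> = (a y \<otimes> a x) \<otimes> word_prod q"
    by (simp only: gens_commute[OF assms(1) y(1,2)])
  also have "\<dots> = a y \<otimes> word_prod (x # q)"
    using y assms(1) by (simp add: word_prod_Cons m_assoc gens_closed word_prod_closed)
  also have "word_prod (x # q) = word_prod (q @ [x])"
    using Cons by simp
  also have "a y \<otimes> word_prod (q @ [x]) = word_prod ((y # q) @ [x])"
    by (simp add: word_prod_Cons)
  finally show ?case .
qed simp

text \<open>Let \<open>z\<close> be the neighbour of \<open>x\<close> other than \<open>y\<close>. All letters of \<open>q\<close> except \<open>z\<close> commute with \<open>x\<close>. If \<open>z\<close> does not occur in \<open>q\<close>,
  the two \<open>x\<close> meet and give a square; if it occurs once, they give \<open>x z x\<close>. If it occurs more often,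
  then two consecutive \<open>z\<close> enclose a shorter word without the neighbour \<open>x\<close> of \<open>z\<close>, and induction applies
  to them.\<close>

lemma word_prod_sandwich_zero:
  assumes "cyc_adj N x y" "set q \<subseteq> {..<N}" "x \<notin> set q" "y \<notin> set q"
  shows "word_prod (x # q @ [x]) = \<zero>"
  using assms
proof (induction "length q" arbitrary: q x y rule: less_induct)
  case less
  have x: "x < N" using less.prems(1) by (rule cyc_adj_less)
  have "set (x # q @ [x]) \<subseteq> {..<N}" using x less.prems(2) by simp
  show ?case
  proof (cases "\<exists>z\<in>set q. cyc_adj N x z")
    case False
    then have "word_prod (x # q) = word_prod (q @ [x])"
      using word_prod_commute_gen[OF x less.prems(2)] by blast
    then have "word_prod ((x # q) @ [x]) = word_prod ((q @ [x]) @ [x])"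
      using x less.prems(2) word_prod_append[of "x # q" "[x]"] word_prod_append[of "q @ [x]" "[x]"] by simp
    also have "\<dots> = word_prod (q @ [x, x] @ [])"
      by simp
    also have "\<dots> = \<zero>"
      using x less.prems(2) by (intro word_prod_zero_context) (auto simp: word_prod_Cons word_prod_Nil gens_closed gens_square)
    finally show ?thesis by simp
  next
    case True
    then obtain q1 z q2 where q: "q = q1 @ z # q2" and z: "cyc_adj N x z"
      and q1: "\<forall>v\<in>set q1. \<not> cyc_adj N x v"
      using split_list_first_prop[OF True] by blast
    have sub: "set q1 \<subseteq> {..<N}" "set q2 \<subseteq> {..<N}" "z < N" using q less.prems(2) by auto
    show ?thesis
    proof (cases "\<exists>v\<in>set q2. cyc_adj N x v")
      case False
      have c1: "word_prod (x # q1) = word_prod (q1 @ [x])" using q1 x sub word_prod_commute_gen by blast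
      have c2: "word_prod (x # q2) = word_prod (q2 @ [x])" using False x sub word_prod_commute_gen by blast
      have "word_prod (x # q @ [x]) = word_prod (x # q1) \<otimes> (a z \<otimes> word_prod (q2 @ [x]))"
        using x sub word_prod_append[of "x # q1" "z # q2 @ [x]"] by (simp add: q word_prod_Cons)
      also have "\<dots> = word_prod (q1 @ [x]) \<otimes> (a z \<otimes> word_prod (x # q2))"
        by (simp only: c1 c2)
      also have "\<dots> = word_prod (q1 @ [x, z, x] @ q2)"
        using x sub word_prod_append[of "q1 @ [x]" "z # x # q2"] by (simp add: word_prod_Cons)
      also have "\<dots> = \<zero>"
        using x sub gens_adjacent[OF z]
        by (intro word_prod_zero_context) (auto simp: word_prod_Cons word_prod_Nil gens_closed m_assoc)
      finally show ?thesis .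
    next
      case True
      then obtain q3 z' q4 where q2: "q2 = q3 @ z' # q4" and z': "cyc_adj N x z'"
        and q3: "\<forall>v\<in>set q3. \<not> cyc_adj N x v"
        using split_list_first_prop[OF True] by blast
      have "z' = z"
        using cyc_adj_other_unique[OF less.prems(1) z z'] less.prems(4) q q2 by auto
      have "word_prod (z # q3 @ [z]) = \<zero>"
        by (rule less.hyps[where y = x])
          (use q q2 q3 z cyc_adj_sym less.prems in auto)
      then have "word_prod ((x # q1) @ (z # q3 @ [z]) @ (q4 @ [x])) = \<zero>"
        using x sub q2 by (intro word_prod_zero_context) auto
      then show ?thesis using q q2 \<open>z' = z\<close> by simp
    qed
  qed
qed

lemma word_prod_nonzero_alternating:
  assumes "set w \<subseteq> {..<N}" "word_prod w \<noteq> \<zero>" "cyc_adj N x y"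
  shows "distinct_adj (filter (\<lambda>z. z = x \<or> z = y) w)"
proof (rule ccontr)
  assume "\<not> ?thesis"
  then obtain p z r where l: "filter (\<lambda>z. z = x \<or> z = y) w = p @ z # z # r"
    by (rule not_distinct_adjE)
  then obtain p' q r' where w: "w = p' @ z # q @ z # r'"
    and q: "\<And>v. v \<in> set q \<Longrightarrow> \<not> (v = x \<or> v = y)"
    by (rule filter_adjacent_equalE) blast
  have "z \<in> set (filter (\<lambda>z. z = x \<or> z = y) w)" using l by simp
  then have "z = x \<or> z = y" by simp
  then obtain v where v: "cyc_adj N z v" "v = x \<or> v = y"
    using assms(3) cyc_adj_sym by blast
  have "word_prod (z # q @ [z]) = \<zero>"
    by (rule word_prod_sandwich_zero[OF v(1)]) (use q v w assms \<open>z = x \<or> z = y\<close> in auto)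
  then have "word_prod (p' @ (z # q @ [z]) @ r') = \<zero>"
    using w assms(1) by (intro word_prod_zero_context) auto
  then show False using w assms(2) by simp
qed

text \<open>The projection lemma for partially commutative words. If \<open>w\<close> starts with \<open>x\<close>, then on each edge at \<open>x\<close> the other word \<open>v\<close>
  also starts with \<open>x\<close>, so nothing before the first \<open>x\<close> in \<open>v\<close> is adjacent to \<open>x\<close>. That \<open>x\<close> can be
  moved to the front and cancelled.\<close>

lemma word_prod_cong_edge_projections:
  assumes "set w \<subseteq> {..<N}" "set v \<subseteq> {..<N}" "edge_projections N w = edge_projections N v"
  shows "word_prod w = word_prod v"
  using assms
proof (induction w arbitrary: v)
  case Nil
  have "v = []"
  proof (rule ccontr)
    assume "v \<noteq> []"
    then obtain x v' where v: "v = x # v'" by (cases v) auto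
    then have "cyc_adj N x ((x + 1) mod N)" using Nil.prems by (intro cyc_adj_succ) auto
    then show False
      using fun_cong[OF Nil.prems(3), of "(x, (x + 1) mod N)"] v by (simp add: edge_projections_def)
  qed
  then show ?case by simp
next
  case (Cons x w)
  have x: "x < N" using Cons.prems by simp
  have proj: "filter (\<lambda>z. z = y \<or> z = y') (x # w) = filter (\<lambda>z. z = y \<or> z = y') v"
    if "cyc_adj N y y'" for y y'
    using fun_cong[OF Cons.prems(3), of "(y, y')"] that by (simp add: edge_projections_def)
  have "x \<in> set (filter (\<lambda>z. z = x \<or> z = (x + 1) mod N) (x # w))"
    by simp
  then have "x \<in> set (filter (\<lambda>z. z = x \<or> z = (x + 1) mod N) v)"
    by (simp only: proj[OF cyc_adj_succ[OF x]])
  then have "x \<in> set v" by simp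
  then obtain p q where v: "v = p @ x # q" and p: "x \<notin> set p"
    using split_list_first[of x v] by blast
  have sub: "set p \<subseteq> {..<N}" "set q \<subseteq> {..<N}" "set w \<subseteq> {..<N}"
    using v Cons.prems by auto
  have empty: "filter (\<lambda>z. z = x \<or> z = y) p = []" if "cyc_adj N x y" for y
  proof (rule ccontr)
    let ?P = "\<lambda>z. z = x \<or> z = y"
    assume "filter ?P p \<noteq> []"
    then have "hd (filter ?P v) \<in> set p"
      using hd_in_set[of "filter ?P p"] v by simp
    moreover have "hd (filter ?P v) = x"
      by (simp flip: proj[OF that])
    ultimately show False using p by simp
  qed
  have p_adj: "\<not> cyc_adj N x y" if "y \<in> set p" for y
    using empty[of y] that by (auto simp: filter_empty_conv)
  have rot: "edge_projections N (x # p) = edge_projections N (p @ [x])"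
    using p p_adj by (intro edge_projections_rotate) auto
  have "edge_projections N w = edge_projections N (p @ q)"
  proof
    fix e
    have "edge_projections N ([x] @ w) e = edge_projections N ((p @ [x]) @ q) e"
      using Cons.prems(3) v by simp
    also have "\<dots> = edge_projections N (p @ [x]) e @ edge_projections N q e"
      by (rule edge_projections_append)
    also have "\<dots> = edge_projections N (x # p) e @ edge_projections N q e"
      by (simp only: rot)
    also have "\<dots> = edge_projections N ([x] @ (p @ q)) e"
      using edge_projections_append[of N "x # p" q e] by simp
    finally have "edge_projections N ([x] @ w) e = edge_projections N ([x] @ (p @ q)) e" .
    then show "edge_projections N w e = edge_projections N (p @ q) e"
      by (simp only: edge_projections_append append_same_eq same_append_eq)
  qed
  then have IH: "word_prod w = word_prod (p @ q)"
    using Cons.IH[of "p @ q"] sub by simp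
  have "word_prod (x # p) = word_prod (p @ [x])"
    using word_prod_commute_gen[OF x sub(1)] p_adj by blast
  then have "word_prod ((x # p) @ q) = word_prod ((p @ [x]) @ q)"
    using x sub word_prod_append[of "x # p" q] word_prod_append[of "p @ [x]" q] by simp
  then show ?case using IH v by (simp add: word_prod_Cons)
qed

section \<open>A central element\<close>

text \<open>The product of any word with the given edge projections; the choice does not matter by
  \<open>word_prod_cong_edge_projections\<close>.\<close>

definition class_prod :: "(nat \<times> nat \<Rightarrow> nat list) \<Rightarrow> 'a"
  where "class_prod s = word_prod (SOME w. set w \<subseteq> {..<N} \<and> edge_projections N w = s)"

lemma class_prod_edge_projections:
  assumes "set w \<subseteq> {..<N}"
  shows "class_prod (edge_projections N w) = word_prod w"
proof -
  let ?P = "\<lambda>v. set v \<subseteq> {..<N} \<and> edge_projections N v = edge_projections N w"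
  have "?P (SOME v. ?P v)" by (rule someI[of ?P w]) (use assms in simp)
  then show ?thesis
    unfolding class_prod_def using assms by (intro word_prod_cong_edge_projections) auto
qed

text \<open>The sum runs over edge projections and not over words: a class of words that differ by commutations must
  contribute once, since the classes matched in the proof of centrality may have different sizes.\<close>

definition turn_sum :: 'a
  where "turn_sum = (\<Oplus>s \<in> edge_projections N ` permutation_words N. class_prod s)"

lemma class_prod_closed_on:
  "(\<And>w. w \<in> W \<Longrightarrow> set w \<subseteq> {..<N}) \<Longrightarrow> class_prod \<in> edge_projections N ` W \<rightarrow> carrier R"
  by (auto simp: class_prod_edge_projections word_prod_closed)

lemma class_prod_permutation_words:
  "class_prod \<in> edge_projections N ` permutation_words N \<rightarrow> carrier R"
  by (rule class_prod_closed_on) (rule set_permutation_words)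

lemma turn_sum_closed: "turn_sum \<in> carrier R"
  unfolding turn_sum_def by (rule finsum_closed[OF class_prod_permutation_words])

text \<open>The products of a generator with \<open>turn_sum\<close> on either side are sums over different index sets, which
  agree only after the vanishing terms are dropped.\<close>

lemma finsum_class_prod_nonzero:
  assumes "finite A" "class_prod \<in> A \<rightarrow> carrier R"
  shows "(\<Oplus>s\<in>A. class_prod s) = (\<Oplus>s\<in>{s \<in> A. class_prod s \<noteq> \<zero>}. class_prod s)"
  by (rule add.finprod_mono_neutral_cong_right) (use assms in auto)

text \<open>Appending a fixed letter is injective on edge projections, so the summands can be reindexed by the longer words.\<close>

lemma turn_sum_mult_right:
  assumes "i < N"
  shows "turn_sum \<otimes> a i =
    (\<Oplus>s \<in> edge_projections N ` (\<lambda>u. u @ [i]) ` permutation_words N. class_prod s)"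
proof -
  let ?f = "\<lambda>s e. s e @ edge_projections N [i] e"
  let ?E = "edge_projections N ` permutation_words N"
  have f: "?f (edge_projections N u) = edge_projections N (u @ [i])" for u
    by (simp add: edge_projections_append fun_eq_iff)
  have img: "?f ` ?E = edge_projections N ` (\<lambda>u. u @ [i]) ` permutation_words N"
    by (simp add: image_image f)
  have closed: "class_prod \<in> ?f ` ?E \<rightarrow> carrier R"
    unfolding img using assms
    by (intro class_prod_closed_on) (use set_permutation_words in fastforce)
  have "inj_on ?f ?E"
    by (auto simp: inj_on_def fun_eq_iff)
  then have "(\<Oplus>s \<in> ?f ` ?E. class_prod s) = (\<Oplus>s \<in> ?E. class_prod (?f s))"
    by (rule finsum_reindex[OF closed])
  also have "\<dots> = (\<Oplus>s \<in> ?E. class_prod s \<otimes> a i)"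
  proof (rule finsum_cong')
    fix s assume "s \<in> ?E"
    then obtain u where u: "set u \<subseteq> {..<N}" "s = edge_projections N u"
      using set_permutation_words by auto
    have "class_prod (?f s) = word_prod (u @ [i])"
      unfolding u(2) f using u(1) assms by (intro class_prod_edge_projections) auto
    also have "\<dots> = class_prod s \<otimes> a i"
      using u assms by (simp add: class_prod_edge_projections word_prod_append word_prod_Cons word_prod_Nil gens_closed)
    finally show "class_prod (?f s) = class_prod s \<otimes> a i" .
  qed (use assms funcset_mem[OF class_prod_permutation_words] in \<open>auto simp: gens_closed\<close>)
  also have "\<dots> = turn_sum \<otimes> a i"
    unfolding turn_sum_def
    by (rule finsum_ldistr[symmetric])
      (use assms class_prod_permutation_words in
        \<open>auto simp: gens_closed finite_permutation_words\<close>)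
  finally show ?thesis by (simp only: img)
qed

lemma turn_sum_mult_left:
  assumes "i < N"
  shows "a i \<otimes> turn_sum =
    (\<Oplus>s \<in> edge_projections N ` (\<lambda>u. i # u) ` permutation_words N. class_prod s)"
proof -
  let ?f = "\<lambda>s e. edge_projections N [i] e @ s e"
  let ?E = "edge_projections N ` permutation_words N"
  have f: "?f (edge_projections N u) = edge_projections N (i # u)" for u
    using edge_projections_append[of N "[i]" u] by (simp add: fun_eq_iff)
  have img: "?f ` ?E = edge_projections N ` (\<lambda>u. i # u) ` permutation_words N"
    by (simp add: image_image f)
  have closed: "class_prod \<in> ?f ` ?E \<rightarrow> carrier R"
    unfolding img using assms
    by (intro class_prod_closed_on) (use set_permutation_words in fastforce)
  have "inj_on ?f ?E"
    by (auto simp: inj_on_def fun_eq_iff)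
  then have "(\<Oplus>s \<in> ?f ` ?E. class_prod s) = (\<Oplus>s \<in> ?E. class_prod (?f s))"
    by (rule finsum_reindex[OF closed])
  also have "\<dots> = (\<Oplus>s \<in> ?E. a i \<otimes> class_prod s)"
  proof (rule finsum_cong')
    fix s assume "s \<in> ?E"
    then obtain u where u: "set u \<subseteq> {..<N}" "s = edge_projections N u"
      using set_permutation_words by auto
    have "class_prod (?f s) = word_prod (i # u)"
      unfolding u(2) f using u(1) assms by (intro class_prod_edge_projections) auto
    also have "\<dots> = a i \<otimes> class_prod s"
      using u assms by (simp add: class_prod_edge_projections word_prod_Cons)
    finally show "class_prod (?f s) = a i \<otimes> class_prod s" .
  qed (use assms funcset_mem[OF class_prod_permutation_words] in \<open>auto simp: gens_closed\<close>)
  also have "\<dots> = a i \<otimes> turn_sum"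
    unfolding turn_sum_def
    by (rule finsum_rdistr[symmetric])
      (use assms class_prod_permutation_words in
        \<open>auto simp: gens_closed finite_permutation_words\<close>)
  finally show ?thesis by (simp only: img)
qed

text \<open>If a neighbour of \<open>i\<close> stood before \<open>i\<close> in \<open>u\<close>, it would be missing between the two \<open>i\<close> of \<open>u @ [i]\<close>, and the
  product would vanish. So the first \<open>i\<close> can be pulled to the front.\<close>

lemma permutation_word_mult_right:
  assumes u: "u \<in> permutation_words N" and i: "i < N" and nz: "word_prod (u @ [i]) \<noteq> \<zero>"
  obtains v where "v \<in> permutation_words N"
    "edge_projections N (i # v) = edge_projections N (u @ [i])"
proof -
  have "i \<in> set u" using u i by (simp add: permutation_words_def)
  then obtain p q where pq: "u = p @ i # q" by (auto simp: in_set_conv_decomp)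
  have dist: "distinct (p @ i # q)" and set_pq: "set (p @ i # q) = {..<N}"
    using u pq by (auto simp: permutation_words_def)
  have "y \<notin> set p" if y: "cyc_adj N i y" for y
  proof
    assume "y \<in> set p"
    then have "y \<notin> set q" using dist by auto
    then have "word_prod (i # q @ [i]) = \<zero>"
      using dist set_pq by (intro word_prod_sandwich_zero[OF y]) auto
    then have "word_prod (p @ (i # q @ [i]) @ []) = \<zero>"
      using set_pq by (intro word_prod_zero_context) auto
    then show False using nz pq by simp
  qed
  then have "edge_projections N (i # p) = edge_projections N (p @ [i])"
    using dist by (intro edge_projections_rotate) auto
  from edge_projections_append_cong[OF this, of "q @ [i]" "q @ [i]"]
  have "edge_projections N (i # p @ q @ [i]) = edge_projections N (u @ [i])"
    using pq by simp
  moreover have "p @ q @ [i] \<in> permutation_words N"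
    using dist set_pq by (auto simp: permutation_words_def)
  ultimately show thesis using that by blast
qed

lemma permutation_word_mult_left:
  assumes u: "u \<in> permutation_words N" and i: "i < N" and nz: "word_prod (i # u) \<noteq> \<zero>"
  obtains v where "v \<in> permutation_words N"
    "edge_projections N (v @ [i]) = edge_projections N (i # u)"
proof -
  have "i \<in> set u" using u i by (simp add: permutation_words_def)
  then obtain p q where pq: "u = p @ i # q" by (auto simp: in_set_conv_decomp)
  have dist: "distinct (p @ i # q)" and set_pq: "set (p @ i # q) = {..<N}"
    using u pq by (auto simp: permutation_words_def)
  have "y \<notin> set q" if y: "cyc_adj N i y" for y
  proof
    assume "y \<in> set q"
    then have "y \<notin> set p" using dist by auto
    then have "word_prod (i # p @ [i]) = \<zero>"
      using dist set_pq by (intro word_prod_sandwich_zero[OF y]) auto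
    then have "word_prod ([] @ (i # p @ [i]) @ q) = \<zero>"
      using set_pq by (intro word_prod_zero_context) auto
    then show False using nz pq by simp
  qed
  then have "edge_projections N (i # q) = edge_projections N (q @ [i])"
    using dist by (intro edge_projections_rotate) auto
  from edge_projections_append_cong[OF refl this, of "i # p"]
  have "edge_projections N ((i # p @ q) @ [i]) = edge_projections N (i # u)"
    using pq by simp
  moreover have "i # p @ q \<in> permutation_words N"
    using dist set_pq by (auto simp: permutation_words_def)
  ultimately show thesis using that by blast
qed

lemma turn_sum_commute_gen:
  assumes i: "i < N"
  shows "turn_sum \<otimes> a i = a i \<otimes> turn_sum"
proof -
  let ?A = "edge_projections N ` (\<lambda>u. u @ [i]) ` permutation_words N"
  let ?B = "edge_projections N ` (\<lambda>u. i # u) ` permutation_words N"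
  have subA: "set (u @ [i]) \<subseteq> {..<N}" and subB: "set (i # u) \<subseteq> {..<N}"
    if "u \<in> permutation_words N" for u
    using that i by (auto simp: permutation_words_def)
  have "{s \<in> ?A. class_prod s \<noteq> \<zero>} = {s \<in> ?B. class_prod s \<noteq> \<zero>}"
  proof (intro equalityI subsetI)
    fix s assume s: "s \<in> {s \<in> ?A. class_prod s \<noteq> \<zero>}"
    then obtain u where u: "u \<in> permutation_words N" "s = edge_projections N (u @ [i])" by auto
    then have "word_prod (u @ [i]) \<noteq> \<zero>"
      using s class_prod_edge_projections[OF subA[OF u(1)]] by auto
    from permutation_word_mult_right[OF u(1) i this] obtain v
      where "v \<in> permutation_words N" "edge_projections N (i # v) = s"
      using u(2) by metis
    then have "s \<in> ?B" by blast
    then show "s \<in> {s \<in> ?B. class_prod s \<noteq> \<zero>}" using s by blast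
  next
    fix s assume s: "s \<in> {s \<in> ?B. class_prod s \<noteq> \<zero>}"
    then obtain u where u: "u \<in> permutation_words N" "s = edge_projections N (i # u)" by auto
    then have "word_prod (i # u) \<noteq> \<zero>"
      using s class_prod_edge_projections[OF subB[OF u(1)]] by auto
    from permutation_word_mult_left[OF u(1) i this] obtain v
      where "v \<in> permutation_words N" "edge_projections N (v @ [i]) = s"
      using u(2) by metis
    then have "s \<in> ?A" by blast
    then show "s \<in> {s \<in> ?A. class_prod s \<noteq> \<zero>}" using s by blast
  qed
  moreover have "class_prod \<in> ?A \<rightarrow> carrier R" "class_prod \<in> ?B \<rightarrow> carrier R"
    using subA subB by (blast intro!: class_prod_closed_on)+
  moreover have "finite ?A" "finite ?B"
    by (simp_all add: finite_permutation_words)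
  ultimately show ?thesis
    using finsum_class_prod_nonzero[of ?A] finsum_class_prod_nonzero[of ?B]
    by (simp only: turn_sum_mult_right[OF i] turn_sum_mult_left[OF i])
qed

text \<open>On an edge, \<open>u\<close> contributes both ends once, and by alternation its second letter differs from the first
  letter of \<open>w\<close> on that edge. Hence \<open>w\<close> determines the order.\<close>

lemma permutation_mult_nonzero_unique:
  assumes u: "u \<in> permutation_words N" and v: "v \<in> permutation_words N"
    and w: "set w = {..<N}" and nz: "word_prod (u @ w) \<noteq> \<zero>" "word_prod (v @ w) \<noteq> \<zero>"
  shows "edge_projections N u = edge_projections N v"
proof
  fix e :: "nat \<times> nat"
  obtain x y where e: "e = (x, y)" by (cases e)
  show "edge_projections N u e = edge_projections N v e"
  proof (cases "cyc_adj N x y")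
    case True
    let ?F = "filter (\<lambda>z. z = x \<or> z = y)"
    have xy: "x < N" "y < N" "x \<noteq> y"
      using True N_ge_3 cyc_adj_irrefl cyc_adj_less by auto
    have proj: "\<exists>b c. ?F p = [b, c] \<and> {b, c} = {x, y} \<and> c \<noteq> hd (?F w)"
      if p: "p \<in> permutation_words N" "word_prod (p @ w) \<noteq> \<zero>" for p
    proof -
      have set_Fp: "set (?F p) = {x, y}"
        using p xy by (auto simp: permutation_words_def)
      have "distinct (?F p)"
        using p by (simp add: permutation_words_def)
      from distinct_card[OF this] have "length (?F p) = 2"
        unfolding set_Fp using xy(3) by simp
      then obtain b c where Fp: "?F p = [b, c]"
        by (auto simp: length_Suc_conv numeral_2_eq_2)
      then have bc: "?F p = [b, c]" "{b, c} = {x, y}"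
        using set_Fp by simp_all
      have "set (p @ w) \<subseteq> {..<N}"
        using p w by (auto simp: permutation_words_def)
      from word_prod_nonzero_alternating[OF this p(2) True]
      have "distinct_adj ([b, c] @ ?F w)" using bc by simp
      moreover have "?F w \<noteq> []"
        using w xy by (auto simp: filter_empty_conv)
      ultimately have "c \<noteq> hd (?F w)"
        by (simp add: distinct_adj_Cons)
      with bc show ?thesis by blast
    qed
    have "?F w \<noteq> []"
      using w xy by (auto simp: filter_empty_conv)
    then have "hd (?F w) \<in> {x, y}"
      using hd_in_set[of "?F w"] by auto
    with proj[OF u nz(1)] proj[OF v nz(2)] xy(3) have "?F u = ?F v"
      by (auto simp: doubleton_eq_iff)
    then show ?thesis using e True by (simp add: edge_projections_def)
  qed (simp add: e edge_projections_def)
qed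

lemma turn_sum_mult_word_prod:
  assumes u: "u \<in> permutation_words N" and w: "set w = {..<N}" and nz: "word_prod (u @ w) \<noteq> \<zero>"
  shows "turn_sum \<otimes> word_prod w = word_prod (u @ w)"
proof -
  let ?E = "edge_projections N ` permutation_words N"
  let ?s = "edge_projections N u"
  have w': "word_prod w \<in> carrier R" using w by (simp add: word_prod_closed)
  have E: "class_prod \<in> ?E \<rightarrow> carrier R"
    by (rule class_prod_permutation_words)
  have mult: "class_prod (edge_projections N v) \<otimes> word_prod w = word_prod (v @ w)"
    if "v \<in> permutation_words N" for v
    using that w by (simp add: class_prod_edge_projections word_prod_append permutation_words_def)
  have mult_closed: "class_prod ?s \<otimes> word_prod w \<in> carrier R"
    using E u w' by (intro m_closed) auto
  have "turn_sum \<otimes> word_prod w = (\<Oplus>s\<in>?E. class_prod s \<otimes> word_prod w)"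
    unfolding turn_sum_def
    by (rule finsum_ldistr) (use E w' in \<open>auto simp: finite_permutation_words\<close>)
  also have "\<dots> = (\<Oplus>s\<in>{?s}. class_prod s \<otimes> word_prod w)"
  proof (rule add.finprod_mono_neutral_cong_right)
    fix s assume "s \<in> ?E - {?s}"
    then obtain v where v: "v \<in> permutation_words N" "s = edge_projections N v" "s \<noteq> ?s" by auto
    then have "word_prod (v @ w) = \<zero>"
      using permutation_mult_nonzero_unique[OF u v(1) w nz] by auto
    then show "class_prod s \<otimes> word_prod w = \<zero>"
      using mult v by simp
  qed (use E w' u in \<open>auto simp: finite_permutation_words\<close>)
  also have "\<dots> = class_prod ?s \<otimes> word_prod w"
    using mult_closed by (simp add: finsum_insert)
  finally show ?thesis using mult[OF u] by simp
qed

lemma long_word_factors: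
  assumes w: "set w \<subseteq> {..<N}" "length w > N * (N + 1)" and nz: "word_prod w \<noteq> \<zero>"
  obtains v where "set v \<subseteq> {..<N}" "length v < length w" "word_prod w = turn_sum \<otimes> word_prod v"
proof -
  let ?u = "first_occurrences {..<N} w" and ?v = "later_occurrences {..<N} w"
  note alt = word_prod_nonzero_alternating[OF w(1) nz]
  have count: "count_list w j \<ge> 2" if "j < N" for j
    by (rule counts_ge_2_if_long[OF _ w that]) (rule alt)
  have "j \<in> set w" if "j < N" for j
  proof (rule ccontr)
    assume "j \<notin> set w"
    then have "count_list w j = 0" by (rule count_notin)
    with count[OF that] show False by linarith
  qed
  with w(1) have set_w: "set w = {..<N}" by blast
  then have set_u: "set ?u = {..<N}"
    unfolding set_first_occurrences by blast
  then have u: "?u \<in> permutation_words N"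
    unfolding permutation_words_def using distinct_first_occurrences by blast
  have "j \<in> set ?v" if "j < N" for j
  proof (rule ccontr)
    assume "j \<notin> set ?v"
    then have "count_list ?v j = 0" by (rule count_notin)
    then have "count_list w j \<le> 1" by (simp add: count_later_occurrences that)
    with count[OF that] show False by linarith
  qed
  then have v: "set ?v = {..<N}"
    using set_later_occurrences[of "{..<N}" w] set_w by blast
  have "edge_projections N (?u @ ?v) = edge_projections N w"
    by (rule edge_projections_first_later[OF _ set_w]) (rule alt)
  then have "word_prod (?u @ ?v) = word_prod w"
    by (intro word_prod_cong_edge_projections) (simp_all add: set_u v w(1))
  then have "word_prod w = turn_sum \<otimes> word_prod ?v"
    using turn_sum_mult_word_prod[OF u v] nz by simp
  moreover have "length ?v < length w"
  proof -
    have "0 \<in> set ?u" using set_u N_ge_3 by simp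
    then have "length ?u > 0" by (rule length_pos_if_in_set)
    then show ?thesis
      using length_first_later_occurrences[of "{..<N}" w] by linarith
  qed
  moreover have "set ?v \<subseteq> {..<N}" using v by simp
  ultimately show thesis using that[of ?v] by simp
qed

end

section \<open>Finite generation over the center\<close>

context ring
begin

lemma ring_centerI:
  "\<lbrakk>z \<in> carrier R; \<And>x. x \<in> carrier R \<Longrightarrow> z \<otimes> x = x \<otimes> z\<rbrakk> \<Longrightarrow> z \<in> ring_center R"
  by (simp add: ring_center_def)

lemma ring_center_closed: "z \<in> ring_center R \<Longrightarrow> z \<in> carrier R"
  by (simp add: ring_center_def)

lemma ring_center_commute: "\<lbrakk>z \<in> ring_center R; x \<in> carrier R\<rbrakk> \<Longrightarrow> z \<otimes> x = x \<otimes> z"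
  by (simp add: ring_center_def)

lemma zero_in_ring_center: "\<zero> \<in> ring_center R"
  by (rule ring_centerI) auto

lemma one_in_ring_center: "\<one> \<in> ring_center R"
  by (rule ring_centerI) auto

lemma add_in_ring_center:
  "\<lbrakk>y \<in> ring_center R; z \<in> ring_center R\<rbrakk> \<Longrightarrow> y \<oplus> z \<in> ring_center R"
  by (rule ring_centerI) (auto simp: ring_center_def l_distr r_distr)

lemma mult_in_ring_center:
  assumes y: "y \<in> ring_center R" and z: "z \<in> ring_center R"
  shows "y \<otimes> z \<in> ring_center R"
proof (rule ring_centerI)
  note carr = ring_center_closed[OF y] ring_center_closed[OF z]
  fix x assume x: "x \<in> carrier R"
  have "y \<otimes> z \<otimes> x = y \<otimes> (x \<otimes> z)"
    using x carr ring_center_commute[OF z x] by (simp add: m_assoc)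
  also have "\<dots> = (y \<otimes> x) \<otimes> z" using x carr by (simp add: m_assoc)
  also have "\<dots> = x \<otimes> y \<otimes> z" by (simp only: ring_center_commute[OF y x])
  finally show "y \<otimes> z \<otimes> x = x \<otimes> (y \<otimes> z)" using x carr by (simp add: m_assoc)
qed (use assms ring_center_closed in auto)

definition central_combinations :: "'a set \<Rightarrow> 'a set"
  where "central_combinations S =
    {x. \<exists>c \<in> S \<rightarrow> ring_center R. x = (\<Oplus>s\<in>S. c s \<otimes> s)}"

lemma zero_in_central_combinations:
  assumes "S \<subseteq> carrier R"
  shows "\<zero> \<in> central_combinations S"
proof -
  have "(\<Oplus>s\<in>S. \<zero> \<otimes> s) = (\<Oplus>s\<in>S. \<zero>)"
    by (rule finsum_cong') (use assms in auto)
  then show ?thesis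
    unfolding central_combinations_def
    by (intro CollectI bexI[of _ "\<lambda>_. \<zero>"]) (auto simp: finsum_zero zero_in_ring_center)
qed

lemma add_in_central_combinations:
  assumes S: "S \<subseteq> carrier R"
    and xy: "x \<in> central_combinations S" "y \<in> central_combinations S"
  shows "x \<oplus> y \<in> central_combinations S"
proof -
  obtain c d where c: "c \<in> S \<rightarrow> ring_center R" "x = (\<Oplus>s\<in>S. c s \<otimes> s)"
    and d: "d \<in> S \<rightarrow> ring_center R" "y = (\<Oplus>s\<in>S. d s \<otimes> s)"
    using xy unfolding central_combinations_def by blast
  have carr: "c s \<in> carrier R" "d s \<in> carrier R" "s \<in> carrier R" if "s \<in> S" for s
    using c(1) d(1) S that ring_center_closed by blast+
  have "x \<oplus> y = (\<Oplus>s\<in>S. c s \<otimes> s \<oplus> d s \<otimes> s)"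
    unfolding c(2) d(2) by (rule finsum_addf[symmetric]) (use carr in auto)
  also have "\<dots> = (\<Oplus>s\<in>S. (c s \<oplus> d s) \<otimes> s)"
    by (rule finsum_cong') (use carr in \<open>auto simp: l_distr\<close>)
  finally show ?thesis
    unfolding central_combinations_def
    by (intro CollectI bexI[of _ "\<lambda>s. c s \<oplus> d s"]) (use c(1) d(1) add_in_ring_center in auto)
qed

lemma mult_in_central_combinations:
  assumes S: "finite S" "S \<subseteq> carrier R" and s: "s \<in> S" and z: "z \<in> ring_center R"
  shows "z \<otimes> s \<in> central_combinations S"
proof -
  have carr: "z \<in> carrier R" "s \<in> carrier R"
    using z s S(2) ring_center_closed by auto
  have "(\<Oplus>v\<in>S. (if v = s then z else \<zero>) \<otimes> v) = (\<Oplus>v\<in>S. if v = s then z \<otimes> v else \<zero>)"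
    by (rule finsum_cong') (use S(2) carr in auto)
  also have "\<dots> = z \<otimes> s"
    using add.finprod_singleton_swap[OF s S(1), of "\<lambda>v. z \<otimes> v"] carr S(2) by auto
  finally show ?thesis
    unfolding central_combinations_def
    by (intro CollectI bexI[of _ "\<lambda>v. if v = s then z else \<zero>"])
      (use z zero_in_ring_center in auto)
qed

end

context affine_nilTL_generators
begin

lemma turn_sum_commute_word_prod:
  assumes "set w \<subseteq> {..<N}"
  shows "turn_sum \<otimes> word_prod w = word_prod w \<otimes> turn_sum"
  using assms
proof (induction w)
  case (Cons i w)
  have i: "i < N" "set w \<subseteq> {..<N}" using Cons.prems by auto
  note carr = turn_sum_closed gens_closed[OF i(1)] word_prod_closed[OF i(2)]
  have "turn_sum \<otimes> word_prod (i # w) = (turn_sum \<otimes> a i) \<otimes> word_prod w"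
    using carr by (simp add: word_prod_Cons m_assoc)
  also have "\<dots> = a i \<otimes> (turn_sum \<otimes> word_prod w)"
    using carr by (simp add: turn_sum_commute_gen[OF i(1)] m_assoc)
  also have "\<dots> = a i \<otimes> (word_prod w \<otimes> turn_sum)"
    by (simp only: Cons.IH[OF i(2)])
  also have "\<dots> = word_prod (i # w) \<otimes> turn_sum"
    using carr by (simp add: word_prod_Cons m_assoc)
  finally show ?case .
qed (simp add: word_prod_Nil turn_sum_closed)

lemma word_prod_central_multiple_of_short:
  assumes turn: "turn_sum \<in> ring_center R" and w: "set w \<subseteq> {..<N}"
  shows "\<exists>z \<in> ring_center R. \<exists>v. set v \<subseteq> {..<N} \<and> length v \<le> N * (N + 1) \<and> word_prod w = z \<otimes> word_prod v"
  using w
proof (induction "length w" arbitrary: w rule: less_induct)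
  case less
  consider "length w \<le> N * (N + 1)" | "word_prod w = \<zero>" | "length w > N * (N + 1)" "word_prod w \<noteq> \<zero>"
    by linarith
  then show ?case
  proof cases
    case 1
    then show ?thesis
      using less.prems word_prod_closed one_in_ring_center by (intro bexI[of _ \<one>] exI[of _ w]) auto
  next
    case 2
    then show ?thesis
      using zero_in_ring_center by (intro bexI[of _ \<zero>] exI[of _ "[]"]) (auto simp: word_prod_Nil)
  next
    case 3
    then obtain v where v: "set v \<subseteq> {..<N}" "length v < length w" "word_prod w = turn_sum \<otimes> word_prod v"
      using long_word_factors less.prems by blast
    from less.hyps[OF v(2,1)] obtain z v' where z: "z \<in> ring_center R"
      and v': "set v' \<subseteq> {..<N}" "length v' \<le> N * (N + 1)" "word_prod v = z \<otimes> word_prod v'"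
      by blast
    have "word_prod w = (turn_sum \<otimes> z) \<otimes> word_prod v'"
      using v(3) v'(3) turn_sum_closed ring_center_closed[OF z] word_prod_closed[OF v'(1)]
      by (simp add: m_assoc)
    then show ?thesis
      using mult_in_ring_center[OF turn z] v' by blast
  qed
qed

text \<open>The set \<open>K\<close> plays the role of the scalars. The spanning hypothesis makes \<open>turn_sum\<close> central,
  and then every product of generators is a central multiple of one of length at most \<open>N (N + 1)\<close>.\<close>

lemma finitely_generated_over_center_if_spanned:
  assumes K: "K \<subseteq> ring_center R"
    and span: "\<And>x. x \<in> carrier R \<Longrightarrow> \<exists>F k. finite F \<and> F \<subseteq> {w. set w \<subseteq> {..<N}} \<and> k \<in> F \<rightarrow> K \<and>
      x = (\<Oplus>w\<in>F. k w \<otimes> word_prod w)"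
  shows "finitely_generated_over R (ring_center R)"
proof -
  have turn: "turn_sum \<in> ring_center R"
  proof (rule ring_centerI)
    fix x assume "x \<in> carrier R"
    then obtain F k where F: "finite F" "F \<subseteq> {w. set w \<subseteq> {..<N}}" "k \<in> F \<rightarrow> K"
      and x: "x = (\<Oplus>w\<in>F. k w \<otimes> word_prod w)"
      using span by blast
    have k: "k w \<in> ring_center R" and m: "word_prod w \<in> carrier R" and w: "set w \<subseteq> {..<N}" if "w \<in> F" for w
      using F K that word_prod_closed by auto
    have fn: "(\<lambda>w. k w \<otimes> word_prod w) \<in> F \<rightarrow> carrier R"
      using k m ring_center_closed by blast
    have "turn_sum \<otimes> x = (\<Oplus>w\<in>F. turn_sum \<otimes> (k w \<otimes> word_prod w))"
      unfolding x by (rule finsum_rdistr[OF F(1) turn_sum_closed fn])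
    also have "\<dots> = (\<Oplus>w\<in>F. k w \<otimes> word_prod w \<otimes> turn_sum)"
    proof (rule finsum_cong')
      fix w assume "w \<in> F"
      note kw = k[OF this] and mw = m[OF this] and w' = w[OF this]
      note carr = turn_sum_closed ring_center_closed[OF kw] mw
      have "turn_sum \<otimes> (k w \<otimes> word_prod w) = (turn_sum \<otimes> k w) \<otimes> word_prod w"
        using carr by (simp add: m_assoc)
      also have "\<dots> = k w \<otimes> (turn_sum \<otimes> word_prod w)"
        using carr by (simp add: ring_center_commute[OF kw turn_sum_closed, symmetric] m_assoc)
      also have "\<dots> = k w \<otimes> word_prod w \<otimes> turn_sum"
        using carr by (simp add: turn_sum_commute_word_prod[OF w'] m_assoc)
      finally show "turn_sum \<otimes> (k w \<otimes> word_prod w) = k w \<otimes> word_prod w \<otimes> turn_sum" .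
    qed (use fn turn_sum_closed in auto)
    also have "\<dots> = x \<otimes> turn_sum"
      unfolding x by (rule finsum_ldistr[OF F(1) turn_sum_closed fn, symmetric])
    finally show "turn_sum \<otimes> x = x \<otimes> turn_sum" .
  qed (rule turn_sum_closed)
  define S where "S = word_prod ` {w. set w \<subseteq> {..<N} \<and> length w \<le> N * (N + 1)}"
  have S: "finite S" "S \<subseteq> carrier R"
    unfolding S_def using word_prod_closed by (auto simp: finite_lists_length_le)
  have "x \<in> central_combinations S" if x_in: "x \<in> carrier R" for x
  proof -
    obtain F k where "finite F" and F: "F \<subseteq> {w. set w \<subseteq> {..<N}}" "k \<in> F \<rightarrow> K"
      and x: "x = (\<Oplus>w\<in>F. k w \<otimes> word_prod w)"
      using span[OF x_in] by blast
    have "(\<Oplus>w\<in>F. k w \<otimes> word_prod w) \<in> central_combinations S"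
      using \<open>finite F\<close> F
    proof (induction F)
      case empty
      then show ?case using zero_in_central_combinations S(2) by simp
    next
      case (insert w F)
      have k: "k w \<in> ring_center R" and w: "set w \<subseteq> {..<N}"
        using insert.prems K by auto
      obtain z v where z: "z \<in> ring_center R"
        and v: "set v \<subseteq> {..<N}" "length v \<le> N * (N + 1)" "word_prod w = z \<otimes> word_prod v"
        using word_prod_central_multiple_of_short[OF turn w] by blast
      have "k w \<otimes> word_prod w = (k w \<otimes> z) \<otimes> word_prod v"
        using v(3) word_prod_closed[OF v(1)] ring_center_closed[OF z] ring_center_closed[OF k]
        by (simp add: m_assoc)
      moreover have "word_prod v \<in> S" unfolding S_def using v by blast
      ultimately have "k w \<otimes> word_prod w \<in> central_combinations S"
        using mult_in_central_combinations[OF S _ mult_in_ring_center[OF k z]] by simp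
      moreover have closed: "k v \<otimes> word_prod v \<in> carrier R" if "v \<in> insert w F" for v
      proof (rule m_closed)
        have "k v \<in> K" using insert.prems(2) that by blast
        then show "k v \<in> carrier R" using K ring_center_closed by blast
        show "word_prod v \<in> carrier R" using insert.prems(1) that by (intro word_prod_closed) blast
      qed
      moreover have "(\<Oplus>w\<in>F. k w \<otimes> word_prod w) \<in> central_combinations S"
        using insert.IH insert.prems by simp
      ultimately show ?case
        using add_in_central_combinations[OF S(2)] insert.hyps
        by (subst finsum_insert) auto
    qed
    then show ?thesis by (simp only: x)
  qed
  then show ?thesis
    unfolding finitely_generated_over_def central_combinations_def using S by blast
qed

end

section \<open>The affine nilTemperley-Lieb algebra\<close>

lemma free_algebra_simps:
  "p \<otimes>\<^bsub>free_algebra X\<^esub> q = p * q" "p \<oplus>\<^bsub>free_algebra X\<^esub> q = p + q"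
  "\<one>\<^bsub>free_algebra X\<^esub> = 1" "\<zero>\<^bsub>free_algebra X\<^esub> = 0"
  "p \<in> carrier (free_algebra X) \<longleftrightarrow> (\<forall>w \<in> Poly_Mapping.keys p. set (letters w) \<subseteq> X)"
  by (simp_all add: free_algebra_def)

lemma gen_mult_word:
  fixes c :: "'k::field"
  shows "gen i * Poly_Mapping.single (Word w) c = Poly_Mapping.single (Word (i # w)) c"
  by (simp add: gen_def mult_single plus_free_monoid_def)

lemma sum_of_terms:
  fixes p :: "'a \<Rightarrow>\<^sub>0 'b::comm_monoid_add"
  shows "p = (\<Sum>w\<in>Poly_Mapping.keys p. Poly_Mapping.single w (Poly_Mapping.lookup p w))"
  by (rule poly_mapping_eqI) (simp add: lookup_sum lookup_single when_def in_keys_iff)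

lemma scalar_commute:
  fixes p :: "'a free_monoid \<Rightarrow>\<^sub>0 'k::field"
  shows "Poly_Mapping.single 0 c * p = p * Poly_Mapping.single 0 c"
proof -
  let ?q = "\<Sum>w\<in>Poly_Mapping.keys p. Poly_Mapping.single w (Poly_Mapping.lookup p w)"
  have "Poly_Mapping.single 0 c * ?q = ?q * Poly_Mapping.single 0 c"
    by (simp add: sum_distrib_left sum_distrib_right mult_single mult.commute)
  then show ?thesis
    by (simp only: sum_of_terms[of p, symmetric])
qed

definition quotient_map :: "nat \<Rightarrow> (nat free_monoid \<Rightarrow>\<^sub>0 'k::field) \<Rightarrow> (nat free_monoid \<Rightarrow>\<^sub>0 'k) set"
  where "quotient_map N p = Idl\<^bsub>free_algebra {..<N}\<^esub> (affine_nilTL_relations N) +>\<^bsub>free_algebra {..<N}\<^esub> p"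

lemma quotient_map_hom:
  "ring_hom_ring (free_algebra {..<N}) (affine_nilTL N) (quotient_map N :: (nat free_monoid \<Rightarrow>\<^sub>0 'k::field) \<Rightarrow> _)"
  unfolding affine_nilTL_def quotient_map_def[abs_def]
  by (intro ideal.rcos_ring_hom_ring ring.genideal_ideal ring_free_algebra
      affine_nilTL_relations_closed)

lemma quotient_map_surj:
  "x \<in> carrier (affine_nilTL N) \<Longrightarrow> \<exists>p \<in> carrier (free_algebra {..<N}). x = quotient_map N p"
  by (auto simp: affine_nilTL_def FactRing_def A_RCOSETS_def' quotient_map_def)

lemma quotient_map_relation:
  assumes "r \<in> affine_nilTL_relations N"
  shows "quotient_map N r = \<zero>\<^bsub>affine_nilTL N :: (nat free_monoid \<Rightarrow>\<^sub>0 'k::field) set ring\<^esub>"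
proof -
  let ?F = "free_algebra {..<N} :: (nat free_monoid \<Rightarrow>\<^sub>0 'k) ring"
  interpret F: ring ?F by (rule ring_free_algebra)
  have "r \<in> Idl\<^bsub>?F\<^esub> (affine_nilTL_relations N)"
    using F.genideal_self[OF affine_nilTL_relations_closed] assms by blast
  then show ?thesis
    using F.a_rcos_zero[OF F.genideal_ideal[OF affine_nilTL_relations_closed]]
    by (simp add: quotient_map_def affine_nilTL_def FactRing_def)
qed

lemma affine_nilTL_generators_quotient:
  assumes "N \<ge> 3"
  shows "affine_nilTL_generators (affine_nilTL N :: (nat free_monoid \<Rightarrow>\<^sub>0 'k::field) set ring) N
    (\<lambda>i. quotient_map N (gen i))"
proof -
  let ?F = "free_algebra {..<N} :: (nat free_monoid \<Rightarrow>\<^sub>0 'k) ring"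
  let ?R = "affine_nilTL N :: (nat free_monoid \<Rightarrow>\<^sub>0 'k) set ring"
  interpret ring_hom_ring ?F ?R "quotient_map N" by (rule quotient_map_hom)
  have g: "gen i \<in> carrier ?F" if "i < N" for i
    using that by (simp add: gen_closed)
  have mult: "quotient_map N (p * q) = quotient_map N p \<otimes>\<^bsub>?R\<^esub> quotient_map N q"
    if "p \<in> carrier ?F" "q \<in> carrier ?F" for p q
    using hom_mult[OF that] by (simp add: free_algebra_simps)
  have gg: "gen i * gen j \<in> carrier ?F" if "i < N" "j < N" for i j
    using R.m_closed[OF g[OF that(1)] g[OF that(2)]] by (simp only: free_algebra_simps)
  have adj: "quotient_map N (gen i) \<otimes>\<^bsub>?R\<^esub> quotient_map N (gen j) \<otimes>\<^bsub>?R\<^esub> quotient_map N (gen i)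
      = quotient_map N (gen i * gen j * gen i)" if "i < N" "j < N" for i j
    by (simp only: mult g gg that)
  show ?thesis
  proof (intro affine_nilTL_generators.intro affine_nilTL_generators_axioms.intro)
    fix i j assume ij: "i < N" "j < N" "\<not> cyc_adj N i j"
    let ?r = "gen i * gen j - gen j * gen i :: nat free_monoid \<Rightarrow>\<^sub>0 'k"
    have r: "?r \<in> affine_nilTL_relations N"
      unfolding affine_nilTL_relations_def using ij cyc_adj_if_cong by blast
    then have "?r \<in> carrier ?F"
      using affine_nilTL_relations_closed by blast
    \<comment> \<open>Adding \<open>gen j * gen i\<close> back to the relation leaves \<open>gen i * gen j\<close>.\<close>
    from hom_add[OF this gg[OF ij(2,1)]]
    have "quotient_map N (gen i * gen j) = quotient_map N (gen j * gen i :: nat free_monoid \<Rightarrow>\<^sub>0 'k)"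
      using gg[OF ij(2,1)] by (simp add: free_algebra_simps(2) quotient_map_relation[OF r])
    then show "quotient_map N (gen i) \<otimes>\<^bsub>?R\<^esub> quotient_map N (gen j)
        = quotient_map N (gen j) \<otimes>\<^bsub>?R\<^esub> quotient_map N (gen i)"
      using ij by (simp add: mult g)
  next
    fix i j assume ij: "cyc_adj N i j"
    then have lt: "i < N" "j < N" by (rule cyc_adj_less)+
    have "(gen i * gen j * gen i :: nat free_monoid \<Rightarrow>\<^sub>0 'k) \<in> affine_nilTL_relations N"
      using ij unfolding affine_nilTL_relations_def cyc_adj_def by blast
    then show "quotient_map N (gen i) \<otimes>\<^bsub>?R\<^esub> quotient_map N (gen j) \<otimes>\<^bsub>?R\<^esub> quotient_map N (gen i)
        = \<zero>\<^bsub>?R\<^esub>"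
      unfolding adj[OF lt] by (rule quotient_map_relation)
  next
    fix i assume i: "i < N"
    then have "(gen i * gen i :: nat free_monoid \<Rightarrow>\<^sub>0 'k) \<in> affine_nilTL_relations N"
      unfolding affine_nilTL_relations_def by blast
    then show "quotient_map N (gen i) \<otimes>\<^bsub>?R\<^esub> quotient_map N (gen i) = \<zero>\<^bsub>?R\<^esub>"
      unfolding mult[OF g[OF i] g[OF i], symmetric] by (rule quotient_map_relation)
  qed (use assms g in \<open>auto intro: S.ring_axioms\<close>)
qed

theorem theorem6p1:
  fixes N :: nat
  assumes "N \<ge> 3"
  shows "finitely_generated_over
           (affine_nilTL N :: (nat free_monoid \<Rightarrow>\<^sub>0 'k::field) set ring)
           (ring_center (affine_nilTL N))"
proof -
  let ?F = "free_algebra {..<N} :: (nat free_monoid \<Rightarrow>\<^sub>0 'k) ring"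
  let ?R = "affine_nilTL N :: (nat free_monoid \<Rightarrow>\<^sub>0 'k) set ring"
  let ?h = "quotient_map N :: (nat free_monoid \<Rightarrow>\<^sub>0 'k) \<Rightarrow> _"
  interpret ring_hom_ring ?F ?R ?h by (rule quotient_map_hom)
  interpret gens: affine_nilTL_generators ?R N "\<lambda>i. ?h (gen i)"
    by (rule affine_nilTL_generators_quotient[OF assms])
  let ?scalar = "\<lambda>c::'k. Poly_Mapping.single 0 c :: nat free_monoid \<Rightarrow>\<^sub>0 'k"
  have scalar: "?scalar c \<in> carrier ?F" for c
    by (simp add: free_algebra_simps zero_free_monoid_def)
  have word: "Poly_Mapping.single (Word w) c \<in> carrier ?F" if "set w \<subseteq> {..<N}" for w and c :: 'k
    using that by (simp add: free_algebra_simps)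
  have mult: "?h (p * q) = ?h p \<otimes>\<^bsub>?R\<^esub> ?h q" if "p \<in> carrier ?F" "q \<in> carrier ?F" for p q
    using hom_mult[OF that] by (simp add: free_algebra_simps)
  have word_prod: "gens.word_prod w = ?h (Poly_Mapping.single (Word w) 1)" if "set w \<subseteq> {..<N}" for w
    using that
  proof (induction w)
    case Nil
    then show ?case
      using hom_one by (simp add: gens.word_prod_Nil free_algebra_simps flip: zero_free_monoid_def)
  next
    case (Cons i w)
    then have "i < N" "set w \<subseteq> {..<N}" by auto
    then show ?case
      using Cons.IH mult[OF gen_closed[of i "{..<N}"] word[of w 1]]
      by (simp add: gens.word_prod_Cons gen_mult_word)
  qed
  have term_image: "?h (Poly_Mapping.single (Word w) c) = ?h (?scalar c) \<otimes>\<^bsub>?R\<^esub> gens.word_prod w"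
    if w: "set w \<subseteq> {..<N}" for w c
    using mult[OF scalar[of c] word[OF w, of 1]] word_prod[OF w] by (simp add: mult_single)
  show ?thesis
  proof (rule gens.finitely_generated_over_center_if_spanned)
    show "range (\<lambda>c. ?h (?scalar c)) \<subseteq> ring_center ?R"
    proof (rule image_subsetI)
      fix c
      show "?h (?scalar c) \<in> ring_center ?R"
      proof (rule S.ring_centerI)
        fix x assume "x \<in> carrier ?R"
        then obtain p where "p \<in> carrier ?F" "x = ?h p" using quotient_map_surj by blast
        then show "?h (?scalar c) \<otimes>\<^bsub>?R\<^esub> x = x \<otimes>\<^bsub>?R\<^esub> ?h (?scalar c)"
          using mult scalar scalar_commute by metis
      qed (simp add: scalar)
    qed
  next
    fix x assume "x \<in> carrier ?R"
    then obtain p where p: "p \<in> carrier ?F" "x = ?h p" using quotient_map_surj by blast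
    define F where "F = letters ` Poly_Mapping.keys p"
    define k where "k w = ?h (?scalar (Poly_Mapping.lookup p (Word w)))" for w
    have F: "finite F" "F \<subseteq> {w. set w \<subseteq> {..<N}}"
      using p(1) by (auto simp: F_def free_algebra_simps)
    have sum: "(\<Sum>w\<in>F. Poly_Mapping.single (Word w) (Poly_Mapping.lookup p (Word w))) = p"
    proof -
      have "inj_on letters (Poly_Mapping.keys p)" by (auto simp: inj_on_def free_monoid.expand)
      then show ?thesis
        unfolding F_def by (simp add: sum.reindex flip: sum_of_terms)
    qed
    have "?h (\<Sum>w\<in>G. Poly_Mapping.single (Word w) (Poly_Mapping.lookup p (Word w)))
        = (\<Oplus>\<^bsub>?R\<^esub>w\<in>G. k w \<otimes>\<^bsub>?R\<^esub> gens.word_prod w)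
        \<and> (\<Sum>w\<in>G. Poly_Mapping.single (Word w) (Poly_Mapping.lookup p (Word w))) \<in> carrier ?F"
      if "finite G" "G \<subseteq> {w. set w \<subseteq> {..<N}}" for G
      using that
    proof (induction G)
      case empty
      then show ?case using hom_zero R.zero_closed by (simp add: free_algebra_simps(4))
    next
      case (insert w G)
      let ?t = "Poly_Mapping.single (Word w) (Poly_Mapping.lookup p (Word w))"
      let ?s = "\<Sum>w\<in>G. Poly_Mapping.single (Word w) (Poly_Mapping.lookup p (Word w))"
      have t: "?t \<in> carrier ?F" and s: "?s \<in> carrier ?F"
        using insert word by auto
      have closed: "k v \<otimes>\<^bsub>?R\<^esub> gens.word_prod v \<in> carrier ?R" if "v \<in> insert w G" for v
        unfolding k_def using insert.prems that scalar by (intro S.m_closed gens.word_prod_closed) auto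
      have "?h (?t + ?s) = ?h ?t \<oplus>\<^bsub>?R\<^esub> ?h ?s"
        using hom_add[OF t s] by (simp add: free_algebra_simps(2))
      moreover have "?t + ?s \<in> carrier ?F"
        using R.a_closed[OF t s] by (simp add: free_algebra_simps(2))
      ultimately show ?case
        using insert closed by (simp add: S.finsum_insert term_image k_def)
    qed
    from this[OF F] have "x = (\<Oplus>\<^bsub>?R\<^esub>w\<in>F. k w \<otimes>\<^bsub>?R\<^esub> gens.word_prod w)"
      by (simp add: sum p(2))
    moreover have "k \<in> F \<rightarrow> range (\<lambda>c. ?h (?scalar c))"
      by (auto simp: k_def)
    ultimately show "\<exists>F k. finite F \<and> F \<subseteq> {w. set w \<subseteq> {..<N}} \<and>
        k \<in> F \<rightarrow> range (\<lambda>c. ?h (?scalar c)) \<and> x = (\<Oplus>\<^bsub>?R\<^esub>w\<in>F. k w \<otimes>\<^bsub>?R\<^esub> gens.word_prod w)"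
      using F by blast
  qed
qed

end
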